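(* With all data as defined in the context, define $\theta,\hat\theta,\bar\theta,\check\theta,h$ on $\Pi_{\rm MR}$ by $$\theta(\pi)=\max_{1\le i\le M}\{v^\pi_{C_i}(x)-b_i\},\quad \hat\theta(\pi)=\max_{1\le j\le\hat M}\{J^\pi_{\gamma,\hat C_j}(x)-\hat b_j\},$$ $$\bar\theta(\pi)=\max_{1\le k\le\bar M}\{v^\pi_{\bar C_k,\bar T_k}(x)-\bar b_k\},\quad \check\theta(\pi)=\max_{1\le l\le\check M}\{J^\pi_{\gamma,\check C_l,\check T_l}(x)-\check b_l\},$$ $$h(\pi)=\max\{\theta(\pi),\hat\theta(\pi),\bar\theta(\pi),\check\theta(\pi)\}$$ (maxima over empty index sets are omitted). Suppose $\mathcal{F}\neq\varnothing$ and $0$ is not a local minimum value of the map $h:\Pi_{\rm MR}\to\mathbb{R}$ (with respect to the topology on $\Pi_{\rm MR}$ induced by the metric $\mu$). Then, for every $\epsilon>0$, there exists $T^*>0$ such that, for every integer $T\ge T^*$ and every policy $\eta\in\mathcal{F}^-_T$ that solves the problem $(P_T^-):\ \min_{\pi\in\mathcal{F}^-_T}J^\pi_{\gamma,R,T}(x)$, the policy $\eta$ is $\epsilon$-optimal for the problem $(P):\ \min_{\pi\in\mathcal{F}}J^\pi_{\gamma,R}(x)$, that is, $\eta\in\mathcal{F}$ and $$0\le J^\eta_{\gamma,R}(x)-\inf_{\pi\in\mathcal{F}}J^\pi_{\gamma,R}(x)<\epsilon.$$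
   Context: **MDP.** $\mathcal{S}=\{s_1,\dots,s_m\}$ and $\mathcal{A}=\{a_1,\dots,a_n\}$ are finite sets of states and actions; $p(s'|s,a)$ is a (time-homogeneous) transition probability from $s$ to $s'$ under action $a$. A Markovian randomized (MR) decision rule $d$ assigns to each state $s$ a probability distribution $d(\cdot|s)$ on $\mathcal{A}$; it is identified with the $m\times n$ row-stochastic matrix with $(i,j)$ entry $d(a_j|s_i)$. An MR policy is a sequence $\pi=\{d_t\}_{t=0}^\infty$ of MR decision rules; $\Pi_{\rm MR}$ is the set of all MR policies. For $x\in\mathcal{S}$, $\mathbb{E}^\pi_x$ denotes expectation for the process $(X_t,A_t)_{t\ge0}$ with $X_0=x$, $A_t\sim d_t(\cdot|X_t)$, $X_{t+1}\sim p(\cdot|X_t,A_t)$. **Costs.** Fix a discount factor $\beta\in(0,1)$ and a risk factor $\gamma\in\mathbb{R}\setminus\{0\}$. For an immediate cost function $R:\mathcal{S}\times\mathcal{A}\to\mathbb{R}$, $x\in\mathcal S$ and integer $T\ge1$, $$J^{\pi}_{\gamma,R}(x)=\mathbb{E}^\pi_x\Big[e^{\gamma\sum_{t=0}^{\infty}\beta^tR(X_t,A_t)}\Big],\quad J^{\pi}_{\gamma,R,T}(x)=\mathbb{E}^\pi_x\Big[e^{\gamma\sum_{t=0}^{T-1}\beta^tR(X_t,A_t)}\Big],$$ $$v^{\pi}_{R}(x)=\mathbb{E}^\pi_x\Big[\sum_{t=0}^{\infty}\beta^tR(X_t,A_t)\Big],\quad v^{\pi}_{R,T}(x)=\mathbb{E}^\pi_x\Big[\sum_{t=0}^{T-1}\beta^tR(X_t,A_t)\Big].$$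 **Constraints.** Fix the initial state $x\in\mathcal{S}$, an objective immediate cost $R$, nonnegative integers $M,\hat M,\bar M,\check M$, at least one nonzero, immediate cost functions $C_i,\hat C_j,\bar C_k,\check C_l:\mathcal{S}\times\mathcal{A}\to\mathbb{R}$, real constants $b_i,\hat b_j,\bar b_k,\check b_l$ and finite horizons (positive integers) $\bar T_k,\check T_l$, where $1\le i\le M$, $1\le j\le\hat M$, $1\le k\le\bar M$, $1\le l\le\check M$. Let $C>0$ be a common bound on the absolute values of all these immediate cost functions (including $R$), $K=C/(1-\beta)$, and $K_T=e^{|\gamma|K\beta^T}$. Define subsets of $\Pi_{\rm MR}$: - $\mathcal{C}=\{\pi: v^\pi_{C_i}(x)\le b_i\ \forall i\}$, $\hat{\mathcal{C}}=\{\pi: J^\pi_{\gamma,\hat C_j}(x)\le\hat b_j\ \forall j\}$, - $\bar{\mathcal{C}}=\{\pi: v^\pi_{\bar C_k,\bar T_k}(x)\le\bar b_k\ \forall k\}$, $\check{\mathcal{C}}=\{\pi: J^\pi_{\gamma,\check C_l,\check T_l}(x)\le\check b_l\ \forall l\}$, - $\mathcal{C}^-_T=\{\pi: v^\pi_{C_i,T}(x)\le b_i-K\beta^T\ \forall i\}$, $\hat{\mathcal{C}}^-_T=\{\pi: J^\pi_{\gamma,\hat C_j,T}(x)\le\hat b_j/K_T\ \forall j\}$. Set $\mathcal{F}=\mathcal{C}\cap\hat{\mathcal{C}}\cap\bar{\mathcal{C}}\cap\check{\mathcal{C}}$ and $\mathcal{F}^-_T=\mathcal{C}^-_T\cap\hat{\mathcal{C}}^-_T\cap\bar{\mathcal{C}}\cap\check{\mathcal{C}}$.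 **Topology.** Fix $\delta\in(\beta,1)$. For $\pi_1=\{d_t\}_{t\ge0}$ and $\pi_2=\{f_t\}_{t\ge0}$ in $\Pi_{\rm MR}$, $\mu(\pi_1,\pi_2)=\sup_{t\ge0}\delta^t\|d_t-f_t\|_\infty$, where $\|B\|_\infty=\max_i\sum_j|b_{i,j}|$ for a matrix $B=[b_{i,j}]$. This is a metric on $\Pi_{\rm MR}$. **Local minimum value.** A real number $c$ is a local minimum value of $h$ if there is a point $\pi$ with $h(\pi)=c$ and a neighborhood of $\pi$ on which $h\ge c$. *)

theory Defs
  imports "HOL-Probability.Probability"
begin

section \<open>Markovian randomized policies\<close>

text \<open>Distributions on the finite types of states and actions are probability mass functions, so
  that every element of the type \<open>('s, 'a) policy\<close> is a Markovian randomized policy and the set of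
  all of them is \<^term>\<open>UNIV\<close>.\<close>

type_synonym ('s, 'a) decision_rule = "'s \<Rightarrow> 'a pmf"
type_synonym ('s, 'a) policy = "nat \<Rightarrow> ('s, 'a) decision_rule"

subsection \<open>The state-action process\<close>

text \<open>A path is a sequence \<open>\<omega>\<close> of pairs with \<open>\<omega> t = (X\<^sub>t, A\<^sub>t)\<close>. Given the
  history \<open>\<omega> 0, \<dots>, \<omega> (t - 1)\<close>, the state \<open>X\<^sub>t\<close> is drawn first and then \<open>A\<^sub>t\<close> is drawn from
  \<open>\<pi> t X\<^sub>t\<close>. The law of the path is the Ionescu-Tulcea limit of these kernels.\<close>

definition next_state :: "('s \<Rightarrow> 'a \<Rightarrow> 's pmf) \<Rightarrow> 's \<Rightarrow> nat \<Rightarrow> (nat \<Rightarrow> 's \<times> 'a) \<Rightarrow> 's pmf" where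
  "next_state p x t \<omega> = (case t of 0 \<Rightarrow> return_pmf x | Suc n \<Rightarrow> p (fst (\<omega> n)) (snd (\<omega> n)))"

definition step_kernel ::
  "('s \<Rightarrow> 'a \<Rightarrow> 's pmf) \<Rightarrow> ('s, 'a) policy \<Rightarrow> 's \<Rightarrow> nat \<Rightarrow> (nat \<Rightarrow> 's \<times> 'a) \<Rightarrow> ('s \<times> 'a) measure" where
  "step_kernel p \<pi> x t \<omega> =
     measure_pmf (next_state p x t \<omega> \<bind> (\<lambda>s. map_pmf (\<lambda>a. (s, a)) (\<pi> t s)))"

lemma Ionescu_Tulcea_step_kernel:
  fixes p :: "'s::finite \<Rightarrow> 'a::finite \<Rightarrow> 's pmf"
  shows "Ionescu_Tulcea (step_kernel p \<pi> x) (\<lambda>_. count_space UNIV)"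
proof (rule Ionescu_Tulcea.intro)
  fix i
  let ?M = "\<lambda>_. count_space UNIV :: ('s \<times> 'a) measure"
  show "step_kernel p \<pi> x i \<in> measurable (PiM {0..<i} ?M) (subprob_algebra (count_space UNIV))"
  proof (cases i)
    case 0
    have "step_kernel p \<pi> x 0 = (\<lambda>_. measure_pmf (map_pmf (\<lambda>a. (x, a)) (\<pi> 0 x)))"
      by (auto simp: step_kernel_def next_state_def bind_return_pmf)
    then show ?thesis
      using 0 by (simp add: measure_pmf_in_subprob_algebra)
  next
    case (Suc n)
    define g where
      "g = (\<lambda>y. measure_pmf (p (fst y) (snd y) \<bind> (\<lambda>s. map_pmf (\<lambda>a. (s, a)) (\<pi> (Suc n) s))))"
    have eq: "step_kernel p \<pi> x i = (\<lambda>\<omega>. g (\<omega> n))"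
      by (auto simp: step_kernel_def next_state_def g_def Suc)
    have comp: "(\<lambda>\<omega>. \<omega> n) \<in> measurable (PiM {0..<i} ?M) (count_space UNIV)"
      using Suc by (intro measurable_component_singleton) auto
    have g: "g \<in> measurable (count_space UNIV) (subprob_algebra (count_space UNIV))"
      by (auto simp: g_def measure_pmf_in_subprob_algebra)
    show ?thesis
      unfolding eq by (rule measurable_compose[OF comp g])
  qed
next
  show "prob_space (step_kernel p \<pi> x i \<omega>)"
    if "\<omega> \<in> space (PiM {0..<i} (\<lambda>_. count_space UNIV :: ('s \<times> 'a) measure))" for i \<omega>
    by (simp add: step_kernel_def measure_pmf.prob_space_axioms)
qed

interpretation IT: Ionescu_Tulcea "step_kernel p \<pi> x" "\<lambda>_. count_space UNIV"
  for p :: "'s::finite \<Rightarrow> 'a::finite \<Rightarrow> 's pmf" and \<pi> x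
  by (rule Ionescu_Tulcea_step_kernel)

definition path_measure ::
  "('s::finite \<Rightarrow> 'a::finite \<Rightarrow> 's pmf) \<Rightarrow> ('s, 'a) policy \<Rightarrow> 's \<Rightarrow> (nat \<Rightarrow> 's \<times> 'a) measure" where
  "path_measure p \<pi> x = IT.PF.lim p \<pi> x"

lemma prob_space_path_measure: "prob_space (path_measure p \<pi> x)"
proof -
  have meas: "(\<lambda>\<omega>. restrict \<omega> {}) \<in>
      measurable (path_measure p \<pi> x) (PiM {} (\<lambda>_. count_space UNIV))"
    unfolding path_measure_def measurable_cong_sets[OF IT.PF.sets_lim refl]
    by (rule measurable_restrict_subset) simp
  have "distr (path_measure p \<pi> x) (PiM {} (\<lambda>_. count_space UNIV)) (\<lambda>\<omega>. restrict \<omega> {}) = IT.CI p \<pi> x {}"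
    unfolding path_measure_def by (rule IT.distr_lim) simp
  moreover have "prob_space (IT.CI p \<pi> x {})"
    by (rule IT.PF.prob_space_P) auto
  ultimately show ?thesis
    using prob_space_distrD[OF meas] by simp
qed

subsection \<open>Cost functionals\<close>

definition v_inf ::
  "('s::finite \<Rightarrow> 'a::finite \<Rightarrow> 's pmf) \<Rightarrow> real \<Rightarrow> ('s \<Rightarrow> 'a \<Rightarrow> real) \<Rightarrow> ('s, 'a) policy \<Rightarrow> 's \<Rightarrow> real" where
  "v_inf p \<beta> R \<pi> x = (\<integral>\<omega>. (\<Sum>t. \<beta> ^ t * R (fst (\<omega> t)) (snd (\<omega> t))) \<partial>path_measure p \<pi> x)"

definition v_fin ::
  "('s::finite \<Rightarrow> 'a::finite \<Rightarrow> 's pmf) \<Rightarrow> real \<Rightarrow> ('s \<Rightarrow> 'a \<Rightarrow> real) \<Rightarrow> nat \<Rightarrow> ('s, 'a) policy \<Rightarrow> 's \<Rightarrow> real" where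
  "v_fin p \<beta> R T \<pi> x = (\<integral>\<omega>. (\<Sum>t<T. \<beta> ^ t * R (fst (\<omega> t)) (snd (\<omega> t))) \<partial>path_measure p \<pi> x)"

definition J_inf ::
  "('s::finite \<Rightarrow> 'a::finite \<Rightarrow> 's pmf) \<Rightarrow> real \<Rightarrow> real \<Rightarrow> ('s \<Rightarrow> 'a \<Rightarrow> real) \<Rightarrow> ('s, 'a) policy \<Rightarrow> 's \<Rightarrow> real" where
  "J_inf p \<beta> \<gamma> R \<pi> x =
     (\<integral>\<omega>. exp (\<gamma> * (\<Sum>t. \<beta> ^ t * R (fst (\<omega> t)) (snd (\<omega> t)))) \<partial>path_measure p \<pi> x)"

definition J_fin ::
  "('s::finite \<Rightarrow> 'a::finite \<Rightarrow> 's pmf) \<Rightarrow> real \<Rightarrow> real \<Rightarrow> ('s \<Rightarrow> 'a \<Rightarrow> real) \<Rightarrow> nat \<Rightarrow> ('s, 'a) policy \<Rightarrow> 's \<Rightarrow> real" where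
  "J_fin p \<beta> \<gamma> R T \<pi> x =
     (\<integral>\<omega>. exp (\<gamma> * (\<Sum>t<T. \<beta> ^ t * R (fst (\<omega> t)) (snd (\<omega> t)))) \<partial>path_measure p \<pi> x)"

section \<open>The metric on policies\<close>

definition rule_matrix :: "('s, 'a) decision_rule \<Rightarrow> 's \<Rightarrow> 'a \<Rightarrow> real" where
  "rule_matrix d s a = pmf (d s) a"

definition max_row_sum :: "('s::finite \<Rightarrow> 'a::finite \<Rightarrow> real) \<Rightarrow> real" where
  "max_row_sum B = Max (range (\<lambda>s. \<Sum>a\<in>UNIV. \<bar>B s a\<bar>))"

definition policy_dist :: "real \<Rightarrow> ('s::finite, 'a::finite) policy \<Rightarrow> ('s, 'a) policy \<Rightarrow> real" where
  "policy_dist \<delta> \<pi>\<^sub>1 \<pi>\<^sub>2 =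
     (SUP t. \<delta> ^ t * max_row_sum (\<lambda>s a. rule_matrix (\<pi>\<^sub>1 t) s a - rule_matrix (\<pi>\<^sub>2 t) s a))"

lemma max_row_sum_ge: "(\<Sum>a\<in>UNIV. \<bar>B s a\<bar>) \<le> max_row_sum B"
  unfolding max_row_sum_def by (intro Max_ge) auto

lemma max_row_sum_le_iff: "max_row_sum B \<le> c \<longleftrightarrow> (\<forall>s. (\<Sum>a\<in>UNIV. \<bar>B s a\<bar>) \<le> c)"
  unfolding max_row_sum_def by (subst Max_le_iff) auto

lemma max_row_sum_nonneg: "0 \<le> max_row_sum B"
  by (rule order_trans[OF _ max_row_sum_ge[of B undefined]]) (simp add: sum_nonneg)

lemma max_row_sum_diff_le_2:
  "max_row_sum (\<lambda>s a. rule_matrix d s a - rule_matrix f s a) \<le> 2"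
  unfolding max_row_sum_le_iff
proof
  fix s
  have "(\<Sum>a\<in>UNIV. \<bar>rule_matrix d s a - rule_matrix f s a\<bar>)
      \<le> (\<Sum>a\<in>UNIV. pmf (d s) a + pmf (f s) a)"
    unfolding rule_matrix_def
    by (intro sum_mono abs_leI) (simp_all add: add_increasing)
  also have "\<dots> = 2"
    by (simp add: sum.distrib sum_pmf_eq_1)
  finally show "(\<Sum>a\<in>UNIV. \<bar>rule_matrix d s a - rule_matrix f s a\<bar>) \<le> 2" .
qed

lemma bdd_above_policy_dist:
  fixes \<pi>\<^sub>1 \<pi>\<^sub>2 :: "('s::finite, 'a::finite) policy"
  assumes "0 \<le> \<delta>" "\<delta> \<le> 1"
  shows "bdd_above (range (\<lambda>t. \<delta> ^ t * max_row_sum (\<lambda>s a. rule_matrix (\<pi>\<^sub>1 t) s a - rule_matrix (\<pi>\<^sub>2 t) s a)))"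
proof (rule bdd_aboveI2)
  fix t
  have "\<delta> ^ t * max_row_sum (\<lambda>s a. rule_matrix (\<pi>\<^sub>1 t) s a - rule_matrix (\<pi>\<^sub>2 t) s a) \<le> 1 * 2"
    using assms
    by (intro mult_mono max_row_sum_diff_le_2 power_le_one max_row_sum_nonneg) auto
  then show "\<delta> ^ t * max_row_sum (\<lambda>s a. rule_matrix (\<pi>\<^sub>1 t) s a - rule_matrix (\<pi>\<^sub>2 t) s a) \<le> 2"
    by simp
qed

lemma policy_dist_ge:
  assumes "0 \<le> \<delta>" "\<delta> \<le> 1"
  shows "\<delta> ^ t * max_row_sum (\<lambda>s a. rule_matrix (\<pi>\<^sub>1 t) s a - rule_matrix (\<pi>\<^sub>2 t) s a)
    \<le> policy_dist \<delta> \<pi>\<^sub>1 \<pi>\<^sub>2"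
  unfolding policy_dist_def by (rule cSUP_upper[OF UNIV_I bdd_above_policy_dist[OF assms]])

lemma Metric_space_policy_dist:
  assumes "0 < \<delta>" "\<delta> < 1"
  shows "Metric_space UNIV (policy_dist \<delta> :: ('s::finite, 'a::finite) policy \<Rightarrow> _)"
proof
  note ge = policy_dist_ge[OF less_imp_le[OF assms(1)] less_imp_le[OF assms(2)]]
  fix x y z :: "('s, 'a) policy"
  show nn: "0 \<le> policy_dist \<delta> x y"
    using ge[of 0 x y] max_row_sum_nonneg[of "\<lambda>s a. rule_matrix (x 0) s a - rule_matrix (y 0) s a"]
    by simp
  show "policy_dist \<delta> x y = policy_dist \<delta> y x"
    unfolding policy_dist_def max_row_sum_def by (simp add: abs_minus_commute)
  show "policy_dist \<delta> x y = 0 \<longleftrightarrow> x = y"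
  proof
    assume 0: "policy_dist \<delta> x y = 0"
    have "pmf (x t s) a = pmf (y t s) a" for t s a
    proof -
      let ?B = "\<lambda>s a. rule_matrix (x t) s a - rule_matrix (y t) s a"
      have "\<delta> ^ t * max_row_sum ?B \<le> 0"
        using ge[of t x y] 0 by simp
      then have "max_row_sum ?B \<le> 0"
        using assms zero_less_power[of \<delta> t] mult_pos_pos[of "\<delta> ^ t" "max_row_sum ?B"] by linarith
      then have "(\<Sum>a\<in>UNIV. \<bar>?B s a\<bar>) \<le> 0"
        by (simp add: max_row_sum_le_iff)
      then have "(\<Sum>a\<in>UNIV. \<bar>?B s a\<bar>) = 0"
        by (intro antisym sum_nonneg) auto
      then show ?thesis
        by (simp add: sum_nonneg_eq_0_iff rule_matrix_def)
    qed
    then show "x = y"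
      by (intro ext pmf_eqI)
  next
    assume "x = y"
    then show "policy_dist \<delta> x y = 0"
      by (simp add: policy_dist_def max_row_sum_def)
  qed
  show "policy_dist \<delta> x z \<le> policy_dist \<delta> x y + policy_dist \<delta> y z"
    unfolding policy_dist_def[of _ x z]
  proof (rule cSUP_least)
    fix t :: nat
    let ?B = "\<lambda>u w. max_row_sum (\<lambda>s a. rule_matrix (u t) s a - rule_matrix (w t) s a)"
    have "?B x z \<le> ?B x y + ?B y z"
      unfolding max_row_sum_le_iff
    proof
      fix s
      have "(\<Sum>a\<in>UNIV. \<bar>rule_matrix (x t) s a - rule_matrix (z t) s a\<bar>)
        \<le> (\<Sum>a\<in>UNIV. \<bar>rule_matrix (x t) s a - rule_matrix (y t) s a\<bar>
             + \<bar>rule_matrix (y t) s a - rule_matrix (z t) s a\<bar>)"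
        by (intro sum_mono) linarith
      also have "\<dots> \<le> ?B x y + ?B y z"
        unfolding sum.distrib
        by (intro add_mono
            max_row_sum_ge[of "\<lambda>s a. rule_matrix (x t) s a - rule_matrix (y t) s a" s]
            max_row_sum_ge[of "\<lambda>s a. rule_matrix (y t) s a - rule_matrix (z t) s a" s])
      finally show "(\<Sum>a\<in>UNIV. \<bar>rule_matrix (x t) s a - rule_matrix (z t) s a\<bar>) \<le> ?B x y + ?B y z" .
    qed
    then have "\<delta> ^ t * ?B x z \<le> \<delta> ^ t * ?B x y + \<delta> ^ t * ?B y z"
      using assms by (simp flip: distrib_left)
    also have "\<dots> \<le> policy_dist \<delta> x y + policy_dist \<delta> y z"
      by (intro add_mono ge)
    finally show "\<delta> ^ t * ?B x z \<le> policy_dist \<delta> x y + policy_dist \<delta> y z" .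
  qed simp
qed

definition local_min_value :: "'b topology \<Rightarrow> ('b \<Rightarrow> real) \<Rightarrow> real \<Rightarrow> bool" where
  "local_min_value X h c \<longleftrightarrow>
     (\<exists>\<pi>\<in>topspace X. h \<pi> = c \<and> (\<exists>U. openin X U \<and> \<pi> \<in> U \<and> (\<forall>\<pi>'\<in>U. c \<le> h \<pi>')))"

end

theory Submission
  imports Defs
begin

text \<open>
  Truncating a discounted cost at time \<open>T\<close> changes it by at most \<open>K \<beta>\<^sup>T\<close> on every path, so the
  additive functional \<open>v\<close> moves by at most \<open>K \<beta>\<^sup>T\<close> and the exponential functional \<open>J\<close> by at most a
  factor \<open>K\<^sub>T\<close>, whatever the policy. The constraints of \<open>P\<^sub>T\<^sup>-\<close> are tightened by exactly these
  amounts. Hence its feasible policies are feasible for \<open>P\<close>, and if \<open>\<eta>\<close> solves \<open>P\<^sub>T\<^sup>-\<close>, then \<open>J(\<eta>)\<close>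
  exceeds the cost \<open>J(\<pi>)\<close> of every feasible policy \<open>\<pi>\<close> of \<open>P\<^sub>T\<^sup>-\<close> by at most the factor
  \<open>K\<^sub>T\<^sup>2\<close>, which tends to \<open>1\<close>. So it remains to find policies that are nearly optimal for \<open>P\<close> and
  feasible for \<open>P\<^sub>T\<^sup>-\<close> for all large \<open>T\<close>.

  A policy with \<open>h < 0\<close> satisfies all constraints of \<open>P\<close> strictly, and therefore satisfies the
  tightened ones for all large \<open>T\<close>. A nearly optimal policy \<open>\<pi>\<close> has \<open>h(\<pi>) \<le> 0\<close>; if
  \<open>h(\<pi>) = 0\<close>, then, as \<open>0\<close> is not a local minimum value, there are policies arbitrarily close to
  \<open>\<pi>\<close> with \<open>h < 0\<close>. Their costs are close to \<open>J(\<pi>)\<close>, because \<open>J\<close> is continuous: the law of the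
  first \<open>T\<close> steps is a polynomial in finitely many entries \<open>d\<^sub>t(a|s)\<close> of the policy
  (lemma \<open>measure_cylinder\<close>), so \<open>J\<close> with horizon \<open>T\<close> is continuous, and the truncation bounds
  hold uniformly in the policy (lemma \<open>tendsto_J_inf\<close>).
\<close>

section \<open>The law of finite path segments\<close>

definition cylinder :: "nat \<Rightarrow> (nat \<Rightarrow> 'b) \<Rightarrow> (nat \<Rightarrow> 'b) set" where
  "cylinder n e = {\<omega>. restrict \<omega> {0..<n} = e}"

abbreviation path_space :: "(nat \<Rightarrow> 'b) measure" where
  "path_space \<equiv> PiM UNIV (\<lambda>_. count_space UNIV)"

lemma sets_path_measure [measurable_cong, simp]: "sets (path_measure p \<pi> x) = sets path_space"
  by (simp add: path_measure_def)

lemma space_path_measure [simp]: "space (path_measure p \<pi> x) = UNIV"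
  by (simp add: path_measure_def space_PiM)

lemma singleton_in_sets_PiM:
  fixes e :: "nat \<Rightarrow> 'b"
  assumes "e \<in> extensional {0..<n}"
  shows "{e} \<in> sets (PiM {0..<n} (\<lambda>_. count_space UNIV))"
proof -
  have "PiE {0..<n} (\<lambda>i. {e i}) \<in> sets (PiM {0..<n} (\<lambda>_. count_space UNIV))"
    by (rule sets_PiM_I_finite) simp_all
  then show ?thesis
    using assms by (simp add: PiE_singleton)
qed

lemma cylinder_eq_prod_emb:
  "cylinder n e = prod_emb UNIV (\<lambda>_. count_space UNIV) {0..<n} {e}"
  by (auto simp: cylinder_def prod_emb_def)

lemma cylinder_in_sets:
  assumes "e \<in> extensional {0..<n}"
  shows "cylinder n e \<in> sets path_space"
  unfolding cylinder_eq_prod_emb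
  by (rule measurable_prod_emb) (simp_all add: singleton_in_sets_PiM assms)

lemma pmf_step_kernel:
  "measure_pmf.prob (N \<bind> (\<lambda>s. map_pmf (\<lambda>a. (s, a)) (d s))) {(s, a)} = pmf N s * pmf (d s) a"
proof -
  have inner: "pmf (map_pmf (\<lambda>a'. (s', a')) (d s')) (s, a) = indicator {s} s' * pmf (d s) a" for s'
  proof (cases "s' = s")
    case True
    then show ?thesis
      using pmf_map_inj'[of "Pair s" "d s" a] by (simp add: inj_def)
  next
    case False
    then show ?thesis
      by (auto simp: pmf_eq_0_set_pmf)
  qed
  have "pmf (N \<bind> (\<lambda>s. map_pmf (\<lambda>a. (s, a)) (d s))) (s, a)
      = (\<integral>s'. indicator {s} s' * pmf (d s) a \<partial>measure_pmf N)"
    unfolding pmf_bind inner ..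
  also have "\<dots> = pmf N s * pmf (d s) a"
    by (simp add: measure_pmf_single)
  finally show ?thesis
    by (simp add: measure_pmf_single)
qed

definition segment_weight ::
  "('s \<Rightarrow> 'a \<Rightarrow> 's pmf) \<Rightarrow> ('s, 'a) policy \<Rightarrow> 's \<Rightarrow> nat \<Rightarrow> (nat \<Rightarrow> 's \<times> 'a) \<Rightarrow> real" where
  "segment_weight p \<pi> x n e =
     (\<Prod>t<n. pmf (next_state p x t e) (fst (e t)) * pmf (\<pi> t (fst (e t))) (snd (e t)))"

lemma segment_weight_nonneg: "0 \<le> segment_weight p \<pi> x n e"
  by (auto simp: segment_weight_def intro!: prod_nonneg)

lemma next_state_restrict:
  "t \<le> n \<Longrightarrow> next_state p x t (restrict e {0..<n}) = next_state p x t e"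
  by (auto simp: next_state_def split: nat.split)

lemma segment_weight_restrict:
  "segment_weight p \<pi> x n (restrict e {0..<n}) = segment_weight p \<pi> x n e"
  unfolding segment_weight_def by (intro prod.cong refl) (simp add: next_state_restrict)

lemma emeasure_kernel_composition:
  fixes p :: "'s::finite \<Rightarrow> 'a::finite \<Rightarrow> 's pmf"
  assumes "e \<in> extensional {0..<n}"
  shows "emeasure (IT.C p \<pi> x 0 n (\<lambda>_. undefined)) {e} = ennreal (segment_weight p \<pi> x n e)"
  using assms
proof (induction n arbitrary: e)
  case 0
  then have "e = (\<lambda>_. undefined)"
    by (auto simp: extensional_def)
  then show ?case
    using singleton_in_sets_PiM[OF 0] by (simp add: segment_weight_def)
next
  case (Suc n)
  let ?PM = "\<lambda>n. PiM {0..<n} (\<lambda>_. count_space UNIV) :: (nat \<Rightarrow> 's \<times> 'a) measure"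
  let ?u = "\<lambda>_. undefined :: 's \<times> 'a"
  define e' where "e' = restrict e {0..<n}"
  define q where "q = pmf (next_state p x n e) (fst (e n)) * pmf (\<pi> n (fst (e n))) (snd (e n))"
  have e': "e' \<in> extensional {0..<n}"
    by (simp add: e'_def)
  have u: "?u \<in> space (?PM 0)"
    by (simp add: space_PiM)
  \<comment> \<open>The kernel appends one coordinate to the history, so it can reach \<open>e\<close> only from \<open>e'\<close>.\<close>
  have step: "emeasure (IT.eP p \<pi> x n \<omega>) {e} = ennreal q * indicator {e'} \<omega>"
    if \<omega>: "\<omega> \<in> space (?PM n)" for \<omega>
  proof -
    have ext: "\<omega> \<in> extensional {0..<n}"
      using \<omega> by (simp add: space_PiM PiE_def)
    have "emeasure (IT.eP p \<pi> x n \<omega>) {e} = emeasure (step_kernel p \<pi> x n \<omega>) (fun_upd \<omega> n -` {e})"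
      using IT.emeasure_eP[OF \<omega> singleton_in_sets_PiM[OF Suc.prems], of p \<pi> x] by simp
    also have "fun_upd \<omega> n -` {e} = (if \<omega> = e' then {e n} else {})"
    proof -
      have "fun_upd \<omega> n y = e \<longleftrightarrow> \<omega> = e' \<and> y = e n" for y
      proof
        assume eq: "fun_upd \<omega> n y = e"
        then have "y = e n"
          by auto
        moreover have "\<omega> i = e' i" for i
          using ext fun_cong[OF eq, of i] by (cases "i < n") (auto simp: e'_def extensional_def)
        ultimately show "\<omega> = e' \<and> y = e n"
          by auto
      next
        assume "\<omega> = e' \<and> y = e n"
        moreover have "fun_upd e' n (e n) i = e i" for i
          using Suc.prems by (auto simp: e'_def extensional_def)
        ultimately show "fun_upd \<omega> n y = e"
          by auto
      qed
      then show ?thesis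
        by auto
    qed
    also have "emeasure (step_kernel p \<pi> x n \<omega>) \<dots> = ennreal q * indicator {e'} \<omega>"
    proof (cases "\<omega> = e'")
      case True
      have "emeasure (step_kernel p \<pi> x n e') {e n} = ennreal q"
        using pmf_step_kernel[of "next_state p x n e" "\<pi> n" "fst (e n)" "snd (e n)"]
        by (simp add: step_kernel_def measure_pmf.emeasure_eq_measure q_def e'_def next_state_restrict)
      with True show ?thesis
        by simp
    qed simp
    finally show ?thesis .
  qed
  have "emeasure (IT.C p \<pi> x 0 (Suc n) ?u) {e}
      = (\<integral>\<^sup>+\<omega>. emeasure (IT.eP p \<pi> x n \<omega>) {e} \<partial>IT.C p \<pi> x 0 n ?u)"
    unfolding IT.C.simps
    using u singleton_in_sets_PiM[OF Suc.prems]
    by (subst emeasure_bind[where N = "?PM (Suc n)"])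
      (auto simp: IT.space_C space_PiM PiE_eq_empty_iff
         measurable_cong_sets[OF IT.sets_C[OF u, of p \<pi> x n, simplified] refl])
  also have "\<dots> = (\<integral>\<^sup>+\<omega>. ennreal q * indicator {e'} \<omega> \<partial>IT.C p \<pi> x 0 n ?u)"
    using u by (intro nn_integral_cong step) (simp add: IT.space_C)
  also have "\<dots> = ennreal q * emeasure (IT.C p \<pi> x 0 n ?u) {e'}"
    using singleton_in_sets_PiM[OF e'] u
    by (intro nn_integral_cmult_indicator) (simp add: IT.sets_C)
  also have "\<dots> = ennreal q * ennreal (segment_weight p \<pi> x n e)"
    unfolding Suc.IH[OF e'] unfolding e'_def segment_weight_restrict ..
  also have "\<dots> = ennreal (segment_weight p \<pi> x (Suc n) e)"
    by (subst ennreal_mult[symmetric])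
      (simp_all add: segment_weight_nonneg, simp_all add: segment_weight_def q_def mult.commute)
  finally show ?case .
qed

text \<open>For given \<open>e\<close>, the right-hand side is a monomial in the entries \<open>\<pi>\<^sub>t(a|s)\<close> of the policy.\<close>

lemma measure_cylinder:
  fixes p :: "'s::finite \<Rightarrow> 'a::finite \<Rightarrow> 's pmf"
  assumes "e \<in> extensional {0..<n}"
  shows "measure (path_measure p \<pi> x) (cylinder n e) = segment_weight p \<pi> x n e"
proof -
  note e = singleton_in_sets_PiM[OF assms]
  have "emeasure (path_measure p \<pi> x) (cylinder n e) = emeasure (IT.CI p \<pi> x {0..<n}) {e}"
    unfolding path_measure_def cylinder_eq_prod_emb by (rule IT.lim) (simp_all add: e)
  also have "\<dots> = emeasure (IT.C p \<pi> x 0 n (\<lambda>_. undefined)) {e}"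
    using IT.emeasure_CI[OF subset_refl e, of p \<pi> x] assms
    by (simp add: prod_emb_id PiE_def)
  also have "\<dots> = ennreal (segment_weight p \<pi> x n e)"
    by (rule emeasure_kernel_composition[OF assms])
  finally show ?thesis
    by (simp add: measure_def segment_weight_nonneg)
qed

lemma integral_path_segment:
  fixes p :: "'s::finite \<Rightarrow> 'a::finite \<Rightarrow> 's pmf" and f :: "(nat \<Rightarrow> 's \<times> 'a) \<Rightarrow> real"
  assumes f: "\<And>\<omega>. f (restrict \<omega> {0..<n}) = f \<omega>"
  shows "(\<integral>\<omega>. f \<omega> \<partial>path_measure p \<pi> x)
    = (\<Sum>e\<in>PiE {0..<n} (\<lambda>_. UNIV). f e * segment_weight p \<pi> x n e)"
proof -
  interpret prob_space "path_measure p \<pi> x"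
    by (rule prob_space_path_measure)
  let ?E = "PiE {0..<n} (\<lambda>_. UNIV) :: (nat \<Rightarrow> 's \<times> 'a) set"
  have fin: "finite ?E"
    by (intro finite_PiE) auto
  have ext: "e \<in> extensional {0..<n}" if "e \<in> ?E" for e
    using that by (simp add: PiE_def)
  have f_sum: "f \<omega> = (\<Sum>e\<in>?E. f e * indicator (cylinder n e) \<omega>)" for \<omega>
  proof -
    have "(\<Sum>e\<in>?E. f e * indicator (cylinder n e) \<omega>)
      = (\<Sum>e\<in>?E. if e = restrict \<omega> {0..<n} then f (restrict \<omega> {0..<n}) else 0)"
      by (intro sum.cong refl) (auto simp: cylinder_def)
    also have "\<dots> = f (restrict \<omega> {0..<n})"
      using fin by simp
    finally show ?thesis
      by (simp add: f)
  qed
  have "(\<integral>\<omega>. f \<omega> \<partial>path_measure p \<pi> x)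
      = (\<integral>\<omega>. (\<Sum>e\<in>?E. f e * indicator (cylinder n e) \<omega>) \<partial>path_measure p \<pi> x)"
    by (subst f_sum) (rule refl)
  also have "\<dots> = (\<Sum>e\<in>?E. f e * measure (path_measure p \<pi> x) (cylinder n e))"
    using ext by (subst Bochner_Integration.integral_sum)
      (auto simp: cylinder_in_sets emeasure_eq_measure intro!: integrable_real_indicator)
  also have "\<dots> = (\<Sum>e\<in>?E. f e * segment_weight p \<pi> x n e)"
    using ext by (intro sum.cong refl) (simp add: measure_cylinder)
  finally show ?thesis .
qed

section \<open>Truncation bounds\<close>

lemma discounted_summable:
  fixes r :: "nat \<Rightarrow> real"
  assumes "0 < \<beta>" "\<beta> < 1" "\<And>t. \<bar>r t\<bar> \<le> c"
  shows "summable (\<lambda>t. \<beta> ^ t * r t)"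
proof (rule summable_comparison_test')
  show "summable (\<lambda>t. c * \<beta> ^ t)"
    using assms by (intro summable_mult summable_geometric) auto
  show "norm (\<beta> ^ t * r t) \<le> c * \<beta> ^ t" for t
    using assms by (simp add: abs_mult mult.commute[of c] mult_left_mono)
qed

lemma discounted_tail_le:
  fixes r :: "nat \<Rightarrow> real"
  assumes "0 < \<beta>" "\<beta> < 1" "\<And>t. \<bar>r t\<bar> \<le> c"
  shows "\<bar>(\<Sum>t. \<beta> ^ t * r t) - (\<Sum>t<T. \<beta> ^ t * r t)\<bar> \<le> c / (1 - \<beta>) * \<beta> ^ T"
proof -
  have geo: "(\<lambda>t. c * \<beta> ^ T * \<beta> ^ t) sums (c * \<beta> ^ T * (1 / (1 - \<beta>)))"
    using assms by (intro sums_mult geometric_sums) auto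
  have "(\<Sum>t. \<beta> ^ t * r t) - (\<Sum>t<T. \<beta> ^ t * r t) = (\<Sum>t. \<beta> ^ (t + T) * r (t + T))"
    using suminf_split_initial_segment[OF discounted_summable[OF assms], where k = T] by simp
  also have "\<bar>\<dots>\<bar> \<le> (\<Sum>t. c * \<beta> ^ T * \<beta> ^ t)"
  proof -
    have "norm (\<Sum>t. \<beta> ^ (t + T) * r (t + T)) \<le> (\<Sum>t. c * \<beta> ^ T * \<beta> ^ t)"
    proof (rule norm_suminf_le)
      show "summable (\<lambda>t. c * \<beta> ^ T * \<beta> ^ t)"
        using geo by (rule sums_summable)
      show "norm (\<beta> ^ (t + T) * r (t + T)) \<le> c * \<beta> ^ T * \<beta> ^ t" for t
      proof -
        have "norm (\<beta> ^ (t + T) * r (t + T)) = \<beta> ^ (t + T) * \<bar>r (t + T)\<bar>"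
          using assms by (simp add: abs_mult)
        also have "\<dots> \<le> \<beta> ^ (t + T) * c"
          using assms by (intro mult_left_mono) auto
        finally show ?thesis
          by (simp add: power_add mult_ac)
      qed
    qed
    then show ?thesis
      by simp
  qed
  also have "\<dots> = c / (1 - \<beta>) * \<beta> ^ T"
    using sums_unique[OF geo] by simp
  finally show ?thesis .
qed

lemma truncated_cost_measurable [measurable]:
  fixes R :: "'s::finite \<Rightarrow> 'a::finite \<Rightarrow> real"
  shows "(\<lambda>\<omega>. \<Sum>t<T. \<beta> ^ t * R (fst (\<omega> t)) (snd (\<omega> t))) \<in> borel_measurable path_space"
    and discounted_cost_measurable [measurable]:
      "(\<lambda>\<omega>. \<Sum>t. \<beta> ^ t * R (fst (\<omega> t)) (snd (\<omega> t))) \<in> borel_measurable path_space"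
proof -
  have [measurable]: "(\<lambda>\<omega>. R (fst (\<omega> t)) (snd (\<omega> t))) \<in> borel_measurable path_space" for t
    by (rule measurable_compose[OF measurable_component_singleton[OF UNIV_I],
          where g = "\<lambda>y. R (fst y) (snd y)"]) simp
  show "(\<lambda>\<omega>. \<Sum>t<T. \<beta> ^ t * R (fst (\<omega> t)) (snd (\<omega> t))) \<in> borel_measurable path_space"
    by measurable
  show "(\<lambda>\<omega>. \<Sum>t. \<beta> ^ t * R (fst (\<omega> t)) (snd (\<omega> t))) \<in> borel_measurable path_space"
    by measurable
qed

locale bounded_cost =
  fixes p :: "'s::finite \<Rightarrow> 'a::finite \<Rightarrow> 's pmf" and \<beta> c :: real and R :: "'s \<Rightarrow> 'a \<Rightarrow> real"
  assumes discount: "0 < \<beta>" "\<beta> < 1" and bound: "\<bar>R s a\<bar> \<le> c"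
begin

abbreviation K :: real where "K \<equiv> c / (1 - \<beta>)"

definition total_cost :: "(nat \<Rightarrow> 's \<times> 'a) \<Rightarrow> real" where
  "total_cost \<omega> = (\<Sum>t. \<beta> ^ t * R (fst (\<omega> t)) (snd (\<omega> t)))"

definition truncated_cost :: "nat \<Rightarrow> (nat \<Rightarrow> 's \<times> 'a) \<Rightarrow> real" where
  "truncated_cost T \<omega> = (\<Sum>t<T. \<beta> ^ t * R (fst (\<omega> t)) (snd (\<omega> t)))"

lemma measurable_costs [measurable]:
  "total_cost \<in> borel_measurable path_space" "truncated_cost T \<in> borel_measurable path_space"
  unfolding total_cost_def[abs_def] truncated_cost_def[abs_def] by measurable

lemma tail_le: "\<bar>total_cost \<omega> - truncated_cost T \<omega>\<bar> \<le> K * \<beta> ^ T"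
  unfolding total_cost_def truncated_cost_def using discount bound by (intro discounted_tail_le)

lemma total_cost_bounded: "\<bar>total_cost \<omega>\<bar> \<le> K"
  using tail_le[of \<omega> 0] by (simp add: truncated_cost_def)

lemma c_nonneg: "0 \<le> c"
  using order_trans[OF abs_ge_zero bound[of undefined undefined]] .

lemma K_nonneg: "0 \<le> K"
  using c_nonneg discount by simp

lemma truncated_cost_bounded: "\<bar>truncated_cost T \<omega>\<bar> \<le> 2 * K"
proof -
  have "K * \<beta> ^ T \<le> K * 1"
    using discount K_nonneg by (intro mult_left_mono power_le_one) auto
  then show ?thesis
    using tail_le[of \<omega> T] total_cost_bounded[of \<omega>] by linarith
qed

lemma integrable_bounded:
  fixes f :: "_ \<Rightarrow> real"
  assumes "f \<in> borel_measurable path_space" "\<And>\<omega>. \<bar>f \<omega>\<bar> \<le> B"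
  shows "integrable (path_measure p \<pi> x) f"
proof -
  interpret prob_space "path_measure p \<pi> x"
    by (rule prob_space_path_measure)
  show ?thesis
    using assms by (intro integrable_const_bound[where B = B]) (simp_all cong: measurable_cong_sets)
qed

lemma integrable_costs:
  "integrable (path_measure p \<pi> x) total_cost" "integrable (path_measure p \<pi> x) (truncated_cost T)"
  using total_cost_bounded truncated_cost_bounded by (auto intro!: integrable_bounded)

lemma integrable_exp_costs:
  "integrable (path_measure p \<pi> x) (\<lambda>\<omega>. exp (\<gamma> * total_cost \<omega>))"
  "integrable (path_measure p \<pi> x) (\<lambda>\<omega>. exp (\<gamma> * truncated_cost T \<omega>))"
proof -
  have le: "\<bar>exp (\<gamma> * y)\<bar> \<le> exp (\<bar>\<gamma>\<bar> * B)" if "\<bar>y\<bar> \<le> B" for y B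
  proof -
    have "\<gamma> * y \<le> \<bar>\<gamma>\<bar> * \<bar>y\<bar>"
      by (metis abs_ge_self abs_mult)
    also have "\<dots> \<le> \<bar>\<gamma>\<bar> * B"
      using that by (intro mult_left_mono) auto
    finally show ?thesis
      by simp
  qed
  show "integrable (path_measure p \<pi> x) (\<lambda>\<omega>. exp (\<gamma> * total_cost \<omega>))"
    by (rule integrable_bounded[where B = "exp (\<bar>\<gamma>\<bar> * K)"])
      (simp_all only: le[OF total_cost_bounded], measurable)
  show "integrable (path_measure p \<pi> x) (\<lambda>\<omega>. exp (\<gamma> * truncated_cost T \<omega>))"
    by (rule integrable_bounded[where B = "exp (\<bar>\<gamma>\<bar> * (2 * K))"])
      (simp_all only: le[OF truncated_cost_bounded], measurable)
qed

lemma v_inf_eq: "v_inf p \<beta> R \<pi> x = (\<integral>\<omega>. total_cost \<omega> \<partial>path_measure p \<pi> x)"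
  by (simp add: v_inf_def total_cost_def)

lemma v_fin_eq: "v_fin p \<beta> R T \<pi> x = (\<integral>\<omega>. truncated_cost T \<omega> \<partial>path_measure p \<pi> x)"
  by (simp add: v_fin_def truncated_cost_def)

lemma J_inf_eq: "J_inf p \<beta> \<gamma> R \<pi> x = (\<integral>\<omega>. exp (\<gamma> * total_cost \<omega>) \<partial>path_measure p \<pi> x)"
  by (simp add: J_inf_def total_cost_def)

lemma J_fin_eq: "J_fin p \<beta> \<gamma> R T \<pi> x = (\<integral>\<omega>. exp (\<gamma> * truncated_cost T \<omega>) \<partial>path_measure p \<pi> x)"
  by (simp add: J_fin_def truncated_cost_def)

lemma v_truncation:
  shows "v_inf p \<beta> R \<pi> x \<le> v_fin p \<beta> R T \<pi> x + K * \<beta> ^ T"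
    and "v_fin p \<beta> R T \<pi> x \<le> v_inf p \<beta> R \<pi> x + K * \<beta> ^ T"
proof -
  interpret prob_space "path_measure p \<pi> x"
    by (rule prob_space_path_measure)
  have "(\<integral>\<omega>. total_cost \<omega> \<partial>path_measure p \<pi> x)
      \<le> (\<integral>\<omega>. truncated_cost T \<omega> + K * \<beta> ^ T \<partial>path_measure p \<pi> x)"
    using tail_le[of _ T]
    by (intro integral_mono) (auto simp: integrable_costs abs_le_iff algebra_simps)
  then show "v_inf p \<beta> R \<pi> x \<le> v_fin p \<beta> R T \<pi> x + K * \<beta> ^ T"
    by (simp add: v_inf_eq v_fin_eq integrable_costs prob_space[simplified])
  have "(\<integral>\<omega>. truncated_cost T \<omega> \<partial>path_measure p \<pi> x)
      \<le> (\<integral>\<omega>. total_cost \<omega> + K * \<beta> ^ T \<partial>path_measure p \<pi> x)"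
    using tail_le[of _ T]
    by (intro integral_mono) (auto simp: integrable_costs abs_le_iff algebra_simps)
  then show "v_fin p \<beta> R T \<pi> x \<le> v_inf p \<beta> R \<pi> x + K * \<beta> ^ T"
    by (simp add: v_inf_eq v_fin_eq integrable_costs prob_space[simplified])
qed

text \<open>The risk-sensitive bound is multiplicative, since an additive error in the exponent is a factor
  of the exponential.\<close>

lemma J_truncation:
  shows "J_inf p \<beta> \<gamma> R \<pi> x \<le> exp (\<bar>\<gamma>\<bar> * K * \<beta> ^ T) * J_fin p \<beta> \<gamma> R T \<pi> x"
    and "J_fin p \<beta> \<gamma> R T \<pi> x \<le> exp (\<bar>\<gamma>\<bar> * K * \<beta> ^ T) * J_inf p \<beta> \<gamma> R \<pi> x"
proof -
  have le: "exp (\<gamma> * y) \<le> exp (\<bar>\<gamma>\<bar> * K * \<beta> ^ T) * exp (\<gamma> * z)" if "\<bar>y - z\<bar> \<le> K * \<beta> ^ T" for y z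
  proof -
    have "\<gamma> * (y - z) \<le> \<bar>\<gamma>\<bar> * \<bar>y - z\<bar>"
      by (metis abs_ge_self abs_mult)
    also have "\<dots> \<le> \<bar>\<gamma>\<bar> * (K * \<beta> ^ T)"
      using that by (intro mult_left_mono) auto
    finally show ?thesis
      by (simp add: exp_add[symmetric] algebra_simps)
  qed
  have "(\<integral>\<omega>. exp (\<gamma> * total_cost \<omega>) \<partial>path_measure p \<pi> x)
      \<le> (\<integral>\<omega>. exp (\<bar>\<gamma>\<bar> * K * \<beta> ^ T) * exp (\<gamma> * truncated_cost T \<omega>) \<partial>path_measure p \<pi> x)"
    by (intro integral_mono le tail_le integrable_exp_costs integrable_mult_right)
  then show "J_inf p \<beta> \<gamma> R \<pi> x \<le> exp (\<bar>\<gamma>\<bar> * K * \<beta> ^ T) * J_fin p \<beta> \<gamma> R T \<pi> x"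
    by (simp add: J_inf_eq J_fin_eq)
  have "(\<integral>\<omega>. exp (\<gamma> * truncated_cost T \<omega>) \<partial>path_measure p \<pi> x)
      \<le> (\<integral>\<omega>. exp (\<bar>\<gamma>\<bar> * K * \<beta> ^ T) * exp (\<gamma> * total_cost \<omega>) \<partial>path_measure p \<pi> x)"
    using tail_le[of _ T]
    by (intro integral_mono le integrable_exp_costs integrable_mult_right) (simp add: abs_minus_commute)
  then show "J_fin p \<beta> \<gamma> R T \<pi> x \<le> exp (\<bar>\<gamma>\<bar> * K * \<beta> ^ T) * J_inf p \<beta> \<gamma> R \<pi> x"
    by (simp add: J_inf_eq J_fin_eq)
qed

end

lemma J_inf_nonneg: "0 \<le> J_inf p \<beta> \<gamma> R \<pi> x"
  unfolding J_inf_def by (rule integral_nonneg_AE) auto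

lemma tendsto_truncation_error:
  fixes \<beta> c :: real
  assumes "0 < \<beta>" "\<beta> < 1"
  shows "(\<lambda>T. c * \<beta> ^ T) \<longlonglongrightarrow> 0" and "(\<lambda>T. exp (c * \<beta> ^ T)) \<longlonglongrightarrow> 1"
proof -
  have "(\<lambda>T. \<beta> ^ T) \<longlonglongrightarrow> 0"
    using assms by (intro LIMSEQ_power_zero) auto
  then show lim: "(\<lambda>T. c * \<beta> ^ T) \<longlonglongrightarrow> 0"
    using tendsto_mult_left[of "\<lambda>T. \<beta> ^ T" 0 sequentially c] by simp
  show "(\<lambda>T. exp (c * \<beta> ^ T)) \<longlonglongrightarrow> 1"
    using tendsto_exp[OF lim] by simp
qed

section \<open>Continuity of the costs in the policy\<close>

lemma tendsto_J_fin:
  fixes p :: "'s::finite \<Rightarrow> 'a::finite \<Rightarrow> 's pmf"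
  assumes "\<And>t s a. ((\<lambda>i. pmf (\<pi>s i t s) a) \<longlongrightarrow> pmf (\<pi> t s) a) F"
  shows "((\<lambda>i. J_fin p \<beta> \<gamma> R T (\<pi>s i) x) \<longlongrightarrow> J_fin p \<beta> \<gamma> R T \<pi> x) F"
proof -
  have eq: "J_fin p \<beta> \<gamma> R T \<pi>' x
    = (\<Sum>e\<in>PiE {0..<T} (\<lambda>_. UNIV). exp (\<gamma> * (\<Sum>t<T. \<beta> ^ t * R (fst (e t)) (snd (e t))))
         * segment_weight p \<pi>' x T e)" for \<pi>'
    unfolding J_fin_def by (rule integral_path_segment) simp
  show ?thesis
    unfolding eq segment_weight_def by (intro tendsto_intros assms)
qed

text \<open>For a fixed horizon \<open>T\<close>, replacing the cost by the horizon-\<open>T\<close> cost at \<open>\<pi>\<close> and at the policies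
  \<open>\<pi>s i\<close> loses a factor \<open>K\<^sub>T\<^sup>2\<close>. As this factor does not depend on the policy, \<open>T\<close> can be chosen
  first, such that it is close enough to \<open>1\<close>.\<close>

lemma (in bounded_cost) tendsto_J_inf:
  assumes conv: "\<And>t s a. ((\<lambda>i. pmf (\<pi>s i t s) a) \<longlongrightarrow> pmf (\<pi> t s) a) F"
  shows "((\<lambda>i. J_inf p \<beta> \<gamma> R (\<pi>s i) x) \<longlongrightarrow> J_inf p \<beta> \<gamma> R \<pi> x) F"
proof (rule order_tendstoI)
  define E where "E T = exp (\<bar>\<gamma>\<bar> * K * \<beta> ^ T)" for T
  have E_pos: "0 < E T" for T
    by (simp add: E_def)
  have E_lim: "E \<longlonglongrightarrow> 1"
    unfolding E_def by (rule tendsto_truncation_error(2)[OF discount])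
  note trunc = J_truncation[where \<gamma> = \<gamma> and x = x, folded E_def]
  {
    fix y assume y: "J_inf p \<beta> \<gamma> R \<pi> x < y"
    have "(\<lambda>T. E T * (E T * J_inf p \<beta> \<gamma> R \<pi> x)) \<longlonglongrightarrow> 1 * (1 * J_inf p \<beta> \<gamma> R \<pi> x)"
      by (intro tendsto_intros E_lim)
    then have "\<forall>\<^sub>F T in sequentially. E T * (E T * J_inf p \<beta> \<gamma> R \<pi> x) < y"
      using y by (intro order_tendstoD(2)) auto
    then obtain T where T: "E T * (E T * J_inf p \<beta> \<gamma> R \<pi> x) < y"
      by (auto simp: eventually_sequentially)
    have "E T * J_fin p \<beta> \<gamma> R T \<pi> x < y"
      using mult_left_mono[OF trunc(2)[where T = T and \<pi> = \<pi>] less_imp_le[OF E_pos[of T]]] T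
      by (rule le_less_trans)
    then have "\<forall>\<^sub>F i in F. E T * J_fin p \<beta> \<gamma> R T (\<pi>s i) x < y"
      by (intro order_tendstoD(2)[OF tendsto_mult_left[OF tendsto_J_fin[OF conv]]])
    then show "\<forall>\<^sub>F i in F. J_inf p \<beta> \<gamma> R (\<pi>s i) x < y"
      by eventually_elim (rule le_less_trans[OF trunc(1)])
  next
    fix y assume y: "y < J_inf p \<beta> \<gamma> R \<pi> x"
    have "(\<lambda>T. E T * (E T * y)) \<longlonglongrightarrow> 1 * (1 * y)"
      by (intro tendsto_intros E_lim)
    then have "\<forall>\<^sub>F T in sequentially. E T * (E T * y) < J_inf p \<beta> \<gamma> R \<pi> x"
      using y by (intro order_tendstoD(2)) auto
    then obtain T where T: "E T * (E T * y) < J_inf p \<beta> \<gamma> R \<pi> x"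
      by (auto simp: eventually_sequentially)
    have "E T * y < J_fin p \<beta> \<gamma> R T \<pi> x"
      using less_le_trans[OF T trunc(1)[where T = T and \<pi> = \<pi>]] E_pos[of T] by simp
    then have "\<forall>\<^sub>F i in F. E T * y < J_fin p \<beta> \<gamma> R T (\<pi>s i) x"
      by (rule order_tendstoD(1)[OF tendsto_J_fin[OF conv]])
    then show "\<forall>\<^sub>F i in F. y < J_inf p \<beta> \<gamma> R (\<pi>s i) x"
    proof eventually_elim
      case (elim i)
      then show ?case
        using less_le_trans[OF elim trunc(2)[where T = T and \<pi> = "\<pi>s i"]] E_pos[of T] by simp
    qed
  }
qed

text \<open>The metric controls the entries at time \<open>t\<close> only up to the factor \<open>\<delta>\<^sup>-\<^sup>t\<close>, so the convergence
  need not be uniform in \<open>t\<close>; costs with a finite horizon see only finitely many times.\<close>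

lemma tendsto_pmf_if_policy_dist_tendsto:
  fixes \<pi> :: "('s::finite, 'a::finite) policy"
  assumes \<delta>: "0 < \<delta>" "\<delta> < 1" and lim: "((\<lambda>i. policy_dist \<delta> \<pi> (\<pi>s i)) \<longlongrightarrow> 0) F"
  shows "((\<lambda>i. pmf (\<pi>s i t s) a) \<longlongrightarrow> pmf (\<pi> t s) a) F"
proof -
  have le: "norm (pmf (\<pi>' t s) a - pmf (\<pi> t s) a) \<le> policy_dist \<delta> \<pi> \<pi>' / \<delta> ^ t" for \<pi>'
  proof -
    let ?B = "\<lambda>s a. rule_matrix (\<pi> t) s a - rule_matrix (\<pi>' t) s a"
    have "\<bar>?B s a\<bar> \<le> (\<Sum>a\<in>UNIV. \<bar>?B s a\<bar>)"
      by (rule member_le_sum) auto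
    also have "\<dots> \<le> max_row_sum ?B"
      by (rule max_row_sum_ge)
    also have "\<dots> \<le> policy_dist \<delta> \<pi> \<pi>' / \<delta> ^ t"
      using policy_dist_ge[of \<delta> t \<pi> \<pi>'] \<delta> by (simp add: pos_le_divide_eq mult.commute)
    finally show ?thesis
      by (simp add: rule_matrix_def abs_minus_commute)
  qed
  have "((\<lambda>i. policy_dist \<delta> \<pi> (\<pi>s i) / \<delta> ^ t) \<longlongrightarrow> 0) F"
    using tendsto_divide[OF lim tendsto_const, of "\<delta> ^ t"] \<delta> by simp
  then have "((\<lambda>i. pmf (\<pi>s i t s) a - pmf (\<pi> t s) a) \<longlongrightarrow> 0) F"
    by (rule Lim_null_comparison[OF always_eventually[OF allI[OF le]]])
  then show ?thesis
    by (rule LIM_zero_cancel)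
qed

section \<open>Approximation by strictly feasible policies\<close>

lemma policies_below_if_not_local_min_value:
  fixes h :: "('s::finite, 'a::finite) policy \<Rightarrow> real"
  assumes \<delta>: "0 < \<delta>" "\<delta> < 1"
    and not_min: "\<not> local_min_value (Metric_space.mtopology UNIV (policy_dist \<delta>)) h (h \<pi>)"
  obtains \<pi>s where "\<And>n. h (\<pi>s n) < h \<pi>" and "(\<lambda>n. policy_dist \<delta> \<pi> (\<pi>s n)) \<longlonglongrightarrow> 0"
proof -
  interpret M: Metric_space UNIV "policy_dist \<delta> :: ('s, 'a) policy \<Rightarrow> _"
    by (rule Metric_space_policy_dist[OF \<delta>])
  have "\<exists>\<pi>'. h \<pi>' < h \<pi> \<and> policy_dist \<delta> \<pi> \<pi>' < r" if "0 < r" for r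
  proof (rule ccontr)
    assume "\<nexists>\<pi>'. h \<pi>' < h \<pi> \<and> policy_dist \<delta> \<pi> \<pi>' < r"
    then have "\<forall>\<pi>'\<in>M.mball \<pi> r. h \<pi> \<le> h \<pi>'"
      by (auto simp: not_less)
    moreover have "openin M.mtopology (M.mball \<pi> r)" "\<pi> \<in> M.mball \<pi> r"
      using that by auto
    ultimately have "local_min_value M.mtopology h (h \<pi>)"
      unfolding local_min_value_def by (metis M.topspace_mtopology UNIV_I)
    with not_min show False ..
  qed
  then have "\<forall>n. \<exists>\<pi>'. h \<pi>' < h \<pi> \<and> policy_dist \<delta> \<pi> \<pi>' < 1 / real (Suc n)"
    by simp
  then obtain \<pi>s where \<pi>s: "\<And>n. h (\<pi>s n) < h \<pi> \<and> policy_dist \<delta> \<pi> (\<pi>s n) < 1 / real (Suc n)"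
    by metis
  have "(\<lambda>n. policy_dist \<delta> \<pi> (\<pi>s n)) \<longlonglongrightarrow> 0"
  proof (rule tendsto_sandwich[OF _ _ tendsto_const LIMSEQ_inverse_real_of_nat])
    show "\<forall>\<^sub>F n in sequentially. 0 \<le> policy_dist \<delta> \<pi> (\<pi>s n)"
      by simp
    show "\<forall>\<^sub>F n in sequentially. policy_dist \<delta> \<pi> (\<pi>s n) \<le> inverse (real (Suc n))"
      using \<pi>s by (auto intro!: always_eventually less_imp_le simp: inverse_eq_divide)
  qed
  with \<pi>s show thesis
    using that by blast
qed

lemma Max_image_interval_less_iff:
  fixes f :: "nat \<Rightarrow> real"
  assumes "n \<noteq> 0"
  shows "Max (f ` {1..n}) < c \<longleftrightarrow> (\<forall>i\<in>{1..n}. f i < c)"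
    and "Max (f ` {1..n}) \<le> c \<longleftrightarrow> (\<forall>i\<in>{1..n}. f i \<le> c)"
  using assms by (auto simp: Max_less_iff Max_le_iff)


theorem theorem3p2:
  fixes p :: "'s::finite \<Rightarrow> 'a::finite \<Rightarrow> 's pmf"
    and \<beta> \<gamma> \<delta> Cmax K :: real
    and KT :: "nat \<Rightarrow> real"
    and x :: 's
    and R :: "'s \<Rightarrow> 'a \<Rightarrow> real"
    and M M_hat M_bar M_check :: nat
    and C C_hat C_bar C_check :: "nat \<Rightarrow> 's \<Rightarrow> 'a \<Rightarrow> real"
    and b b_hat b_bar b_check :: "nat \<Rightarrow> real"
    and T_bar T_check :: "nat \<Rightarrow> nat"
    and F :: "('s, 'a) policy set"
    and F_minus :: "nat \<Rightarrow> ('s, 'a) policy set"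
    and \<theta> \<theta>_hat \<theta>_bar \<theta>_check h :: "('s, 'a) policy \<Rightarrow> real"
  assumes "0 < \<beta>" and "\<beta> < 1" and "\<gamma> \<noteq> 0" and "\<beta> < \<delta>" and "\<delta> < 1"
    and "M \<noteq> 0 \<or> M_hat \<noteq> 0 \<or> M_bar \<noteq> 0 \<or> M_check \<noteq> 0"
    and "\<forall>k\<in>{1..M_bar}. 1 \<le> T_bar k"
    and "\<forall>l\<in>{1..M_check}. 1 \<le> T_check l"
    and "0 < Cmax"
    and "\<forall>s a. \<bar>R s a\<bar> \<le> Cmax"
    and "\<forall>i\<in>{1..M}. \<forall>s a. \<bar>C i s a\<bar> \<le> Cmax"
    and "\<forall>j\<in>{1..M_hat}. \<forall>s a. \<bar>C_hat j s a\<bar> \<le> Cmax"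
    and "\<forall>k\<in>{1..M_bar}. \<forall>s a. \<bar>C_bar k s a\<bar> \<le> Cmax"
    and "\<forall>l\<in>{1..M_check}. \<forall>s a. \<bar>C_check l s a\<bar> \<le> Cmax"
  defines "K \<equiv> Cmax / (1 - \<beta>)"
    and "KT \<equiv> \<lambda>T. exp (\<bar>\<gamma>\<bar> * K * \<beta> ^ T)"
    and "F \<equiv>
          {\<pi>. \<forall>i\<in>{1..M}. v_inf p \<beta> (C i) \<pi> x \<le> b i}
        \<inter> {\<pi>. \<forall>j\<in>{1..M_hat}. J_inf p \<beta> \<gamma> (C_hat j) \<pi> x \<le> b_hat j}
        \<inter> {\<pi>. \<forall>k\<in>{1..M_bar}. v_fin p \<beta> (C_bar k) (T_bar k) \<pi> x \<le> b_bar k}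
        \<inter> {\<pi>. \<forall>l\<in>{1..M_check}. J_fin p \<beta> \<gamma> (C_check l) (T_check l) \<pi> x \<le> b_check l}"
    and "F_minus \<equiv> \<lambda>T.
          {\<pi>. \<forall>i\<in>{1..M}. v_fin p \<beta> (C i) T \<pi> x \<le> b i - K * \<beta> ^ T}
        \<inter> {\<pi>. \<forall>j\<in>{1..M_hat}. J_fin p \<beta> \<gamma> (C_hat j) T \<pi> x \<le> b_hat j / KT T}
        \<inter> {\<pi>. \<forall>k\<in>{1..M_bar}. v_fin p \<beta> (C_bar k) (T_bar k) \<pi> x \<le> b_bar k}
        \<inter> {\<pi>. \<forall>l\<in>{1..M_check}. J_fin p \<beta> \<gamma> (C_check l) (T_check l) \<pi> x \<le> b_check l}"
    and "\<theta> \<equiv> \<lambda>\<pi>. Max ((\<lambda>i. v_inf p \<beta> (C i) \<pi> x - b i) ` {1..M})"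
    and "\<theta>_hat \<equiv> \<lambda>\<pi>. Max ((\<lambda>j. J_inf p \<beta> \<gamma> (C_hat j) \<pi> x - b_hat j) ` {1..M_hat})"
    and "\<theta>_bar \<equiv> \<lambda>\<pi>. Max ((\<lambda>k. v_fin p \<beta> (C_bar k) (T_bar k) \<pi> x - b_bar k) ` {1..M_bar})"
    and "\<theta>_check \<equiv> \<lambda>\<pi>. Max ((\<lambda>l. J_fin p \<beta> \<gamma> (C_check l) (T_check l) \<pi> x - b_check l) ` {1..M_check})"
    and "h \<equiv> \<lambda>\<pi>. Max ((if M = 0 then {} else {\<theta> \<pi>})
        \<union> (if M_hat = 0 then {} else {\<theta>_hat \<pi>})
        \<union> (if M_bar = 0 then {} else {\<theta>_bar \<pi>})
        \<union> (if M_check = 0 then {} else {\<theta>_check \<pi>}))"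
  assumes "F \<noteq> {}"
    and "\<not> local_min_value (Metric_space.mtopology UNIV (policy_dist \<delta>)) h 0"
  shows "\<forall>\<epsilon>>0. \<exists>T_star>0. \<forall>T\<ge>T_star. \<forall>\<eta>\<in>F_minus T.
      (\<forall>\<pi>\<in>F_minus T. J_fin p \<beta> \<gamma> R T \<eta> x \<le> J_fin p \<beta> \<gamma> R T \<pi> x) \<longrightarrow>
        \<eta> \<in> F \<and>
        0 \<le> J_inf p \<beta> \<gamma> R \<eta> x - (INF \<pi>\<in>F. J_inf p \<beta> \<gamma> R \<pi> x) \<and>
        J_inf p \<beta> \<gamma> R \<eta> x - (INF \<pi>\<in>F. J_inf p \<beta> \<gamma> R \<pi> x) < \<epsilon>"
proof (intro allI impI)
  fix \<epsilon> :: real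
  assume "0 < \<epsilon>"
  have F_iff: "\<pi> \<in> F \<longleftrightarrow> h \<pi> \<le> 0" for \<pi>
    using assms(6) unfolding F_def h_def \<theta>_def \<theta>_hat_def \<theta>_bar_def \<theta>_check_def
    by (subst Max_le_iff) (auto simp: Max_image_interval_less_iff)
  have strict: "(\<forall>i\<in>{1..M}. v_inf p \<beta> (C i) \<pi> x < b i)
      \<and> (\<forall>j\<in>{1..M_hat}. J_inf p \<beta> \<gamma> (C_hat j) \<pi> x < b_hat j)" if "h \<pi> < 0" for \<pi>
    using that assms(6) unfolding h_def \<theta>_def \<theta>_hat_def
    by (subst (asm) Max_less_iff) (auto simp: Max_image_interval_less_iff split: if_splits)
  have KT_pos: "0 < KT T" for T
    by (simp add: KT_def)
  have KT_lim: "KT \<longlonglongrightarrow> 1"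
    unfolding KT_def using tendsto_truncation_error(2)[OF assms(1,2)] .
  have cost: "bounded_cost \<beta> Cmax R'" if "\<forall>s a. \<bar>R' s a\<bar> \<le> Cmax" for R' :: "'s \<Rightarrow> 'a \<Rightarrow> real"
    using that assms(1,2) by unfold_locales auto
  have cost_v: "bounded_cost \<beta> Cmax (C i)" if "i \<in> {1..M}" for i
    using that assms(11) by (intro cost) blast
  have cost_J: "bounded_cost \<beta> Cmax (C_hat j)" if "j \<in> {1..M_hat}" for j
    using that assms(12) by (intro cost) blast
  note cost_R = cost[OF assms(10)]
  have KT_eq: "KT T = exp (\<bar>\<gamma>\<bar> * K * \<beta> ^ T)" for T
    by (simp add: KT_def)
  note v_trunc = bounded_cost.v_truncation[where \<beta> = \<beta> and c = Cmax, folded K_def]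
  note J_trunc = bounded_cost.J_truncation[where \<beta> = \<beta> and c = Cmax and \<gamma> = \<gamma>,
      folded K_def, folded KT_eq]

  have F_minus_subset: "\<pi> \<in> F" if "\<pi> \<in> F_minus T" for \<pi> T
  proof -
    have "v_inf p \<beta> (C i) \<pi> x \<le> b i" if i: "i \<in> {1..M}" for i
    proof -
      have "v_fin p \<beta> (C i) T \<pi> x \<le> b i - K * \<beta> ^ T"
        using \<open>\<pi> \<in> F_minus T\<close> i unfolding F_minus_def by blast
      then show ?thesis
        using v_trunc(1)[OF cost_v[OF i], of p \<pi> x T] by linarith
    qed
    moreover have "J_inf p \<beta> \<gamma> (C_hat j) \<pi> x \<le> b_hat j" if j: "j \<in> {1..M_hat}" for j
    proof -
      have "J_fin p \<beta> \<gamma> (C_hat j) T \<pi> x \<le> b_hat j / KT T"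
        using \<open>\<pi> \<in> F_minus T\<close> j unfolding F_minus_def by blast
      then have "KT T * J_fin p \<beta> \<gamma> (C_hat j) T \<pi> x \<le> b_hat j"
        using KT_pos[of T] by (simp add: pos_le_divide_eq mult.commute)
      then show ?thesis
        by (rule order_trans[OF J_trunc(1)[OF cost_J[OF j]]])
    qed
    ultimately show ?thesis
      using that unfolding F_def F_minus_def by blast
  qed

  \<comment> \<open>A strictly feasible policy keeps a margin that absorbs the vanishing tightening.\<close>
  have eventually_F_minus: "\<forall>\<^sub>F T in sequentially. \<pi> \<in> F_minus T" if neg: "h \<pi> < 0" for \<pi>
  proof -
    have "\<forall>\<^sub>F T in sequentially. v_fin p \<beta> (C i) T \<pi> x \<le> b i - K * \<beta> ^ T" if i: "i \<in> {1..M}" for i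
    proof -
      have "\<forall>\<^sub>F T in sequentially. 2 * K * \<beta> ^ T < b i - v_inf p \<beta> (C i) \<pi> x"
        using strict[OF neg] i
        by (intro order_tendstoD(2)[OF tendsto_truncation_error(1)[OF assms(1,2)]]) simp
      then show ?thesis
      proof eventually_elim
        case (elim T)
        then show ?case
          using v_trunc(2)[OF cost_v[OF i], of p T \<pi> x] by linarith
      qed
    qed
    moreover have "\<forall>\<^sub>F T in sequentially. J_fin p \<beta> \<gamma> (C_hat j) T \<pi> x \<le> b_hat j / KT T"
      if j: "j \<in> {1..M_hat}" for j
    proof -
      have "(\<lambda>T. KT T * (KT T * J_inf p \<beta> \<gamma> (C_hat j) \<pi> x)) \<longlonglongrightarrow> 1 * (1 * J_inf p \<beta> \<gamma> (C_hat j) \<pi> x)"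
        by (intro tendsto_intros KT_lim)
      then have "\<forall>\<^sub>F T in sequentially. KT T * (KT T * J_inf p \<beta> \<gamma> (C_hat j) \<pi> x) < b_hat j"
        using strict[OF neg] j by (intro order_tendstoD(2)) auto
      then show ?thesis
      proof eventually_elim
        case (elim T)
        have "KT T * J_fin p \<beta> \<gamma> (C_hat j) T \<pi> x \<le> KT T * (KT T * J_inf p \<beta> \<gamma> (C_hat j) \<pi> x)"
          using KT_pos[of T] by (intro mult_left_mono J_trunc(2)[OF cost_J[OF j]]) auto
        then have "KT T * J_fin p \<beta> \<gamma> (C_hat j) T \<pi> x \<le> b_hat j"
          using elim by linarith
        then show ?case
          using KT_pos[of T] by (simp add: pos_le_divide_eq mult.commute)
      qed
    qed
    ultimately have "\<forall>\<^sub>F T in sequentially.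
        (\<forall>i\<in>{1..M}. v_fin p \<beta> (C i) T \<pi> x \<le> b i - K * \<beta> ^ T)
      \<and> (\<forall>j\<in>{1..M_hat}. J_fin p \<beta> \<gamma> (C_hat j) T \<pi> x \<le> b_hat j / KT T)"
      by (simp only: eventually_conj_iff eventually_ball_finite_distrib[OF finite_atLeastAtMost])
        blast
    moreover have "\<pi> \<in> F"
      using neg by (simp add: F_iff)
    ultimately show ?thesis
      by (elim eventually_mono) (auto simp: F_def F_minus_def)
  qed

  have strictly_feasible_near: "\<exists>\<pi>'. h \<pi>' < 0 \<and> J_inf p \<beta> \<gamma> R \<pi>' x < y"
    if \<pi>: "\<pi> \<in> F" and y: "J_inf p \<beta> \<gamma> R \<pi> x < y" for \<pi> y
  proof (cases "h \<pi> < 0")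
    case True
    with y show ?thesis
      by blast
  next
    case False
    then have 0: "h \<pi> = 0"
      using \<pi> by (simp add: F_iff)
    have \<delta>: "0 < \<delta>" "\<delta> < 1"
      using assms(1,4,5) by auto
    obtain \<pi>s where neg: "\<And>n. h (\<pi>s n) < h \<pi>"
      and lim: "(\<lambda>n. policy_dist \<delta> \<pi> (\<pi>s n)) \<longlonglongrightarrow> 0"
      using policies_below_if_not_local_min_value[OF \<delta>, of h \<pi>] assms(25) 0 by metis
    have "(\<lambda>n. J_inf p \<beta> \<gamma> R (\<pi>s n) x) \<longlonglongrightarrow> J_inf p \<beta> \<gamma> R \<pi> x"
      by (intro bounded_cost.tendsto_J_inf[OF cost_R] tendsto_pmf_if_policy_dist_tendsto[OF \<delta> lim])
    then have "\<forall>\<^sub>F n in sequentially. J_inf p \<beta> \<gamma> R (\<pi>s n) x < y"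
      using y by (rule order_tendstoD(2))
    then obtain n where "J_inf p \<beta> \<gamma> R (\<pi>s n) x < y"
      by (auto simp: eventually_sequentially)
    with neg[of n] 0 show ?thesis
      by auto
  qed

  define m where "m = (INF \<pi>\<in>F. J_inf p \<beta> \<gamma> R \<pi> x)"
  have bdd: "bdd_below ((\<lambda>\<pi>. J_inf p \<beta> \<gamma> R \<pi> x) ` F)"
    using J_inf_nonneg by (rule bdd_belowI2)
  have "m < m + \<epsilon>"
    using \<open>0 < \<epsilon>\<close> by simp
  then obtain \<pi> where "\<pi> \<in> F" and "J_inf p \<beta> \<gamma> R \<pi> x < m + \<epsilon>"
    unfolding m_def using cINF_less_iff[OF \<open>F \<noteq> {}\<close> bdd] by blast
  then obtain \<pi>' where neg: "h \<pi>' < 0" and lt: "J_inf p \<beta> \<gamma> R \<pi>' x < m + \<epsilon>"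
    using strictly_feasible_near by blast
  have "(\<lambda>T. KT T * (KT T * J_inf p \<beta> \<gamma> R \<pi>' x)) \<longlonglongrightarrow> 1 * (1 * J_inf p \<beta> \<gamma> R \<pi>' x)"
    by (intro tendsto_intros KT_lim)
  then have "\<forall>\<^sub>F T in sequentially. KT T * (KT T * J_inf p \<beta> \<gamma> R \<pi>' x) < m + \<epsilon>"
    using lt by (intro order_tendstoD(2)) auto
  with eventually_F_minus[OF neg]
  have "\<forall>\<^sub>F T in sequentially. \<pi>' \<in> F_minus T \<and> KT T * (KT T * J_inf p \<beta> \<gamma> R \<pi>' x) < m + \<epsilon>"
    by (rule eventually_conj)
  then obtain T0 where T0: "\<And>T. T0 \<le> T \<Longrightarrow> \<pi>' \<in> F_minus T"
      "\<And>T. T0 \<le> T \<Longrightarrow> KT T * (KT T * J_inf p \<beta> \<gamma> R \<pi>' x) < m + \<epsilon>"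
    unfolding eventually_sequentially by blast

  have "\<eta> \<in> F \<and> 0 \<le> J_inf p \<beta> \<gamma> R \<eta> x - m \<and> J_inf p \<beta> \<gamma> R \<eta> x - m < \<epsilon>"
    if T: "Suc T0 \<le> T" and \<eta>: "\<eta> \<in> F_minus T"
      and opt: "\<forall>\<pi>\<in>F_minus T. J_fin p \<beta> \<gamma> R T \<eta> x \<le> J_fin p \<beta> \<gamma> R T \<pi> x" for T \<eta>
  proof (intro conjI)
    show "\<eta> \<in> F"
      using \<eta> by (rule F_minus_subset)
    then show "0 \<le> J_inf p \<beta> \<gamma> R \<eta> x - m"
      using cINF_lower[OF bdd] by (simp add: m_def)
    have "J_inf p \<beta> \<gamma> R \<eta> x \<le> KT T * J_fin p \<beta> \<gamma> R T \<eta> x"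
      by (rule J_trunc(1)[OF cost_R])
    also have "\<dots> \<le> KT T * J_fin p \<beta> \<gamma> R T \<pi>' x"
      using opt T0(1)[of T] T KT_pos[of T] by (intro mult_left_mono) auto
    also have "\<dots> \<le> KT T * (KT T * J_inf p \<beta> \<gamma> R \<pi>' x)"
      using KT_pos[of T] by (intro mult_left_mono J_trunc(2)[OF cost_R]) auto
    also have "\<dots> < m + \<epsilon>"
      using T0(2)[of T] T by simp
    finally show "J_inf p \<beta> \<gamma> R \<eta> x - m < \<epsilon>"
      by simp
  qed
  then show "\<exists>T_star>0. \<forall>T\<ge>T_star. \<forall>\<eta>\<in>F_minus T.
      (\<forall>\<pi>\<in>F_minus T. J_fin p \<beta> \<gamma> R T \<eta> x \<le> J_fin p \<beta> \<gamma> R T \<pi> x) \<longrightarrow>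
        \<eta> \<in> F \<and>
        0 \<le> J_inf p \<beta> \<gamma> R \<eta> x - (INF \<pi>\<in>F. J_inf p \<beta> \<gamma> R \<pi> x) \<and>
        J_inf p \<beta> \<gamma> R \<eta> x - (INF \<pi>\<in>F. J_inf p \<beta> \<gamma> R \<pi> x) < \<epsilon>"
    unfolding m_def by (intro exI[of _ "Suc T0"]) simp
qed

end
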